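(* Let $m,q \in \mathbb{N}_0$. (a) For any integer $r\ge 1$: - $\binom{2^r m}{2^r q} \equiv \binom mq \pmod 2$ and $\binom{2^r m}{2^r q} \equiv \binom mq \pmod 4$; - $\binom{2^r m}{2^r q} \equiv \binom mq\,(1+2q(m-q)) \pmod 8$; and if $r=1$ this congruence also holds modulo $16$; - if $r\ge 2$, then $\binom{2^r m}{2^r q} \equiv \binom mq\,(1+10q(m-q)) \pmod{16}$. (b) For $1\le r \le 3$: $$\binom{2^r m}{2^r q+1} \equiv 0 \pmod{2^r} \qquad\text{and}\qquad \binom{2^r m}{2^r q+1} \equiv 2^r(m-q) \binom mq \pmod{2^{r+1}}.$$
   Context: $\mathbb{N}_0=\{0,1,2,\dots\}$; $\binom{n}{k}=0$ for integers $k>n\ge 0$. *)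

theory Defs
  imports "HOL-Number_Theory.Number_Theory"
begin

end

theory Submission
  imports Defs
begin

text \<open>
  Let \<open>D n = 1 \<cdot> 3 \<cdots> (2n - 1)\<close>. Removing the powers of two from the factorials shows that
  \<open>binom(2m, 2q) \<cdot> D q \<cdot> D (m - q) = binom(m, q) \<cdot> D m\<close>. Modulo 16,
  \<open>D (p + q) = D p \<cdot> D q \<cdot> (1 + 2pq + 8 binom(p, 2) binom(q, 2))\<close>, and the last term does not matter
  because \<open>binom(p + q, q) binom(p, 2) binom(q, 2)\<close> is a multiple of \<open>binom(4, 2) = 6\<close>. As each \<open>D n\<close>
  is odd it can be cancelled, which is the case \<open>r = 1\<close> of (a); iterating it gives all other \<open>r\<close>.
  Part (b) follows from (a) by the absorption identity relating neighbouring binomial coefficients.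
\<close>

section \<open>Odd double factorials\<close>

text \<open>The double factorial \<open>(2n - 1)!!\<close>, written \<open>D n\<close> above; it
  takes values in \<open>int\<close>, where the congruences live.\<close>

definition odd_fact :: "nat \<Rightarrow> int" where
  "odd_fact n = (\<Prod>i<n. 2 * int i + 1)"

lemma odd_fact_0 [simp]: "odd_fact 0 = 1"
  by (simp add: odd_fact_def)

lemma odd_fact_Suc [simp]: "odd_fact (Suc n) = (2 * int n + 1) * odd_fact n"
  by (simp add: odd_fact_def mult.commute)

lemma odd_odd_fact: "odd (odd_fact n)"
  by (induction n) auto

lemma fact_double_odd_fact: "(fact (2 * n) :: int) = 2 ^ n * fact n * odd_fact n"
  by (induction n) (simp_all add: algebra_simps)

text \<open>After multiplication by \<open>2 ^ (p + q) * q! * p!\<close>, both sides become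
  \<open>(2 * (p + q))!\<close>. Writing \<open>m\<close> as \<open>p + q\<close> avoids truncated
  subtraction.\<close>

lemma binomial_double_odd_fact:
  "int ((2 * (p + q)) choose (2 * q)) * (odd_fact q * odd_fact p)
     = int ((p + q) choose q) * odd_fact (p + q)"
proof -
  let ?c = "2 ^ (p + q) * (fact q * fact p) :: int"
  have "fact (2 * q) * fact (2 * p) * int ((2 * (p + q)) choose (2 * q)) = fact (2 * (p + q))"
    using arg_cong[OF binomial_fact_lemma[of "2 * q" "2 * (p + q)"], of int]
    by (simp add: add_mult_distrib2)
  moreover have f: "fact q * fact p * int ((p + q) choose q) = fact (p + q)"
    using arg_cong[OF binomial_fact_lemma[of q "p + q"], of int] by simp
  ultimately have "?c * (int ((2 * (p + q)) choose (2 * q)) * (odd_fact q * odd_fact p))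
      = ?c * (int ((p + q) choose q) * odd_fact (p + q))"
    unfolding fact_double_odd_fact f[symmetric] by (simp add: power_add mult_ac)
  then show ?thesis
    by simp
qed

lemma int_choose_two: "2 * int (n choose 2) = int n * (int n - 1)"
  by (induction n) (simp_all add: numeral_2_eq_2 algebra_simps)

text \<open>Induction on \<open>p\<close>: the left side gains the factor
  \<open>2(p + q) + 1\<close>, the right side gains \<open>2p + 1\<close> while its last bracket
  changes. The two effects agree modulo 16.\<close>

lemma odd_fact_add_cong:
  "[odd_fact (p + q) = odd_fact p * odd_fact q *
      (1 + 2 * int p * int q + 8 * int (p choose 2) * int (q choose 2))] (mod 16)"
proof (induction p)
  case 0
  then show ?case by (simp add: binomial_eq_0)
next
  case (Suc p)
  let ?c = "int (p choose 2)" and ?d = "int (q choose 2)"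
  have c: "int (Suc p choose 2) = ?c + int p"
    by (simp add: numeral_2_eq_2)
  have d: "int q * int q = 2 * ?d + int q"
    using int_choose_two[of q] by (simp add: algebra_simps)
  have "(2 * (int p + int q) + 1) * (1 + 2 * int p * int q + 8 * ?c * ?d)
      - (2 * int p + 1) * (1 + 2 * (int p + 1) * int q + 8 * (?c + int p) * ?d)
      = 4 * int p * (int q * int q) - 4 * int p * int q + 16 * ?c * ?d * int q
        - (2 * int p + 1) * 8 * int p * ?d"
    by (simp add: algebra_simps)
  \<comment> \<open>Replacing \<open>q * q\<close> by \<open>2 * ?d + q\<close> turns the first two
    terms into \<open>8 * p * ?d\<close>, which cancels part of the last term and leaves
    \<open>- 16 * p * p * ?d\<close>.\<close>
  also have "\<dots> = 16 * (?c * ?d * int q - int p * int p * ?d)"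
    unfolding d by (simp add: algebra_simps)
  finally have step: "[(2 * (int p + int q) + 1) * (1 + 2 * int p * int q + 8 * ?c * ?d)
      = (2 * int p + 1) * (1 + 2 * (int p + 1) * int q + 8 * (?c + int p) * ?d)] (mod 16)"
    unfolding cong_iff_dvd_diff by simp
  have "[odd_fact (Suc p + q) = (2 * (int p + int q) + 1) *
      (odd_fact p * odd_fact q * (1 + 2 * int p * int q + 8 * ?c * ?d))] (mod 16)"
    using cong_mult[OF cong_refl Suc.IH, of "2 * (int p + int q) + 1"] by simp
  also have "(2 * (int p + int q) + 1) *
      (odd_fact p * odd_fact q * (1 + 2 * int p * int q + 8 * ?c * ?d))
      = odd_fact p * odd_fact q *
        ((2 * (int p + int q) + 1) * (1 + 2 * int p * int q + 8 * ?c * ?d))"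
    by (simp only: mult_ac)
  also have "[\<dots> = odd_fact p * odd_fact q *
      ((2 * int p + 1) * (1 + 2 * (int p + 1) * int q + 8 * (?c + int p) * ?d))] (mod 16)"
    by (intro cong_mult cong_refl step)
  also have "odd_fact p * odd_fact q *
      ((2 * int p + 1) * (1 + 2 * (int p + 1) * int q + 8 * (?c + int p) * ?d))
      = odd_fact (Suc p) * odd_fact q *
        (1 + 2 * int (Suc p) * int q + 8 * int (Suc p choose 2) * ?d)"
    unfolding c odd_fact_Suc by (simp only: of_nat_Suc mult_ac add_ac)
  finally show ?case .
qed

section \<open>Doubling both arguments modulo 16\<close>

text \<open>The product counts splittings of \<open>p + q\<close> points into blocks of sizes
  \<open>p\<close> and \<open>q\<close> with a marked pair in each. Choosing the four marked points
  first gives \<open>binom(p + q, 4) * 6 * binom(p + q - 4, p - 2)\<close>.\<close>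

lemma even_binomial_mult_choose_two:
  "even (((p + q) choose q) * (p choose 2) * (q choose 2))"
proof (cases "2 \<le> p \<and> 2 \<le> q")
  case True
  then have p: "2 \<le> p" and q: "2 \<le> q" by auto
  let ?m = "p + q"
  have "(?m choose q) * (q choose 2) = (?m choose 2) * ((?m - 2) choose (q - 2))"
    using q by (intro choose_mult) auto
  also have "(?m - 2) choose (q - 2) = (?m - 2) choose p"
    using binomial_symmetric[of p "?m - 2"] q by simp
  finally have "(?m choose q) * (p choose 2) * (q choose 2)
      = (?m choose 2) * (((?m - 2) choose p) * (p choose 2))"
    by (simp add: mult_ac)
  also have "((?m - 2) choose p) * (p choose 2)
      = ((?m - 2) choose 2) * ((?m - 2 - 2) choose (p - 2))"
    using p q by (intro choose_mult) auto
  also have "(?m choose 2) * (((?m - 2) choose 2) * ((?m - 2 - 2) choose (p - 2)))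
      = ((?m choose 2) * ((?m - 2) choose (4 - 2))) * ((?m - 2 - 2) choose (p - 2))"
    by simp
  also have "(?m choose 2) * ((?m - 2) choose (4 - 2)) = (?m choose 4) * (4 choose 2)"
    using p q by (intro choose_mult[symmetric]) auto
  also have "(4 choose 2 :: nat) = 6"
    by (simp add: choose_two)
  finally show ?thesis by simp
next
  case False
  then show ?thesis
    by (auto simp: binomial_eq_0)
qed

lemma binomial_double_cong:
  "[int ((2 * m) choose (2 * q)) = int (m choose q) * (1 + 2 * int q * (int m - int q))] (mod 16)"
proof (cases "q \<le> m")
  case True
  define p where "p = m - q"
  have m: "m = p + q" using True by (simp add: p_def)
  let ?B = "int ((p + q) choose q)" and ?D = "odd_fact q * odd_fact p"
    and ?e = "int (p choose 2) * int (q choose 2)"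
  have "even (?B * ?e)"
    using even_binomial_mult_choose_two[of p q]
    by (simp flip: of_nat_mult add: mult.assoc)
  then have "8 * 2 dvd 8 * (?B * ?e)"
    by (intro mult_dvd_mono) auto
  then have e: "[8 * (?B * ?e) = 0] (mod 16)"
    by (simp add: cong_0_iff)
  have "[int ((2 * (p + q)) choose (2 * q)) * ?D
      = ?B * (odd_fact p * odd_fact q * (1 + 2 * int p * int q +
          8 * int (p choose 2) * int (q choose 2)))] (mod 16)"
    unfolding binomial_double_odd_fact by (intro cong_mult cong_refl odd_fact_add_cong)
  also have "?B * (odd_fact p * odd_fact q * (1 + 2 * int p * int q +
          8 * int (p choose 2) * int (q choose 2)))
      = (?B * (1 + 2 * int q * int p) + 8 * (?B * ?e)) * ?D"
    by (simp add: algebra_simps)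
  also have "[\<dots> = (?B * (1 + 2 * int q * int p) + 0) * ?D] (mod 16)"
    by (intro cong_mult cong_add cong_refl e)
  finally have "[int ((2 * (p + q)) choose (2 * q)) * ?D
      = ?B * (1 + 2 * int q * int p) * ?D] (mod 16)"
    by simp
  \<comment> \<open>With 16 as a power of 2, coprimality reduces to \<open>?D\<close> being odd, so
    \<open>?D\<close> can be cancelled.\<close>
  moreover have "coprime ?D (2 ^ 4)"
    unfolding coprime_power_right_iff using odd_odd_fact by simp
  ultimately have "[int ((2 * (p + q)) choose (2 * q)) = ?B * (1 + 2 * int q * int p)] (mod 16)"
    by (simp add: cong_mult_rcancel)
  then show ?thesis by (simp add: m)
qed (simp add: binomial_eq_0)

text \<open>Either \<open>q\<close> or \<open>m - q\<close> is even unless \<open>q\<close> is odd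
  and \<open>m\<close> is even. In that case
  \<open>q * binom(m, q) = m * binom(m - 1, q - 1)\<close> forces the binomial coefficient to be
  even.\<close>

lemma even_binomial_mult:
  "even (int (m choose q) * (int q * (int m - int q)))"
proof (cases "even q \<or> odd m")
  case False
  then have q: "odd q" and m: "even m" by auto
  have "q * (m choose q) = m * ((m - 1) choose (q - 1))"
    using q by (intro times_binomial_minus1_eq) (auto intro: odd_pos)
  then have "even (m choose q)"
    using q m by (metis even_mult_iff)
  then show ?thesis by simp
qed auto

section \<open>Iterated doubling: part (a)\<close>

text \<open>With \<open>x = q(m - q)\<close>, two doublings give \<open>(1 + 2x)(1 + 8x)\<close>,
  which is \<open>1 + 10x\<close> modulo 16. Every further doubling contributes a factor congruent
  to 1.\<close>

lemma binomial_pow2_cong_16: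
  assumes "r \<ge> 2"
  shows "[int ((2 ^ r * m) choose (2 ^ r * q))
           = int (m choose q) * (1 + 10 * int q * (int m - int q))] (mod 16)"
  using assms
proof (induction r rule: dec_induct)
  case base
  let ?x = "int q * (int m - int q)"
  have "[int ((2 * (2 * m)) choose (2 * (2 * q)))
      = int ((2 * m) choose (2 * q)) * (1 + 8 * ?x)] (mod 16)"
    using binomial_double_cong[of "2 * m" "2 * q"] by (simp add: algebra_simps)
  also have "[int ((2 * m) choose (2 * q)) * (1 + 8 * ?x)
      = int (m choose q) * (1 + 2 * int q * (int m - int q)) * (1 + 8 * ?x)] (mod 16)"
    by (intro cong_mult cong_refl binomial_double_cong)
  also have "int (m choose q) * (1 + 2 * int q * (int m - int q)) * (1 + 8 * ?x)
      = int (m choose q) * (1 + 10 * int q * (int m - int q))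
        + 16 * (int (m choose q) * ?x * ?x)"
    by (simp add: algebra_simps)
  also have "[\<dots> = int (m choose q) * (1 + 10 * int q * (int m - int q))] (mod 16)"
    by (simp add: cong_iff_dvd_diff)
  finally show ?case by simp
next
  case (step r)
  \<comment> \<open>This exposes the factor 16 in \<open>2 ^ r * 2 ^ r\<close>, so that the
    correction term vanishes modulo 16.\<close>
  obtain s where s: "r = s + 2"
    using step.hyps(1) by (metis le_add_diff_inverse2)
  let ?A = "int ((2 ^ r * m) choose (2 ^ r * q))"
  have "[int ((2 * (2 ^ r * m)) choose (2 * (2 ^ r * q)))
      = ?A * (1 + 2 * int (2 ^ r * q) * (int (2 ^ r * m) - int (2 ^ r * q)))] (mod 16)"
    by (rule binomial_double_cong)
  also have "?A * (1 + 2 * int (2 ^ r * q) * (int (2 ^ r * m) - int (2 ^ r * q)))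
      = ?A + 16 * (2 * 2 ^ s * 2 ^ s * ?A * int q * (int m - int q))"
    by (simp add: s power_add algebra_simps)
  also have "[\<dots> = ?A] (mod 16)"
    by (simp add: cong_iff_dvd_diff)
  also note step.IH
  finally show ?case by (simp add: mult.assoc)
qed

lemma binomial_pow2_cong_8:
  assumes "r \<ge> 1"
  shows "[int ((2 ^ r * m) choose (2 ^ r * q))
           = int (m choose q) * (1 + 2 * int q * (int m - int q))] (mod 8)"
proof (cases "r = 1")
  case True
  then show ?thesis
    using cong_dvd_modulus[OF binomial_double_cong, of 8 m q] by simp
next
  case False
  with assms have "[int ((2 ^ r * m) choose (2 ^ r * q))
      = int (m choose q) * (1 + 10 * int q * (int m - int q))] (mod 8)"
    by (intro cong_dvd_modulus[OF binomial_pow2_cong_16]) auto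
  also have "int (m choose q) * (1 + 10 * int q * (int m - int q))
      = int (m choose q) * (1 + 2 * int q * (int m - int q))
        + 8 * (int (m choose q) * int q * (int m - int q))"
    by (simp add: algebra_simps)
  also have "[\<dots> = int (m choose q) * (1 + 2 * int q * (int m - int q))] (mod 8)"
    by (simp add: cong_iff_dvd_diff)
  finally show ?thesis .
qed

text \<open>The correction term modulo 8 is twice an even number, by
  \<open>even_binomial_mult\<close>.\<close>

lemma binomial_pow2_cong_4:
  assumes "r \<ge> 1"
  shows "[int ((2 ^ r * m) choose (2 ^ r * q)) = int (m choose q)] (mod 4)"
proof -
  let ?y = "int (m choose q) * (int q * (int m - int q))"
  have "[int ((2 ^ r * m) choose (2 ^ r * q))
      = int (m choose q) * (1 + 2 * int q * (int m - int q))] (mod 4)"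
    by (intro cong_dvd_modulus[OF binomial_pow2_cong_8[OF assms]]) auto
  also have "int (m choose q) * (1 + 2 * int q * (int m - int q)) = int (m choose q) + 2 * ?y"
    by (simp add: algebra_simps)
  also have "2 * 2 dvd 2 * ?y"
    by (intro mult_dvd_mono even_binomial_mult) auto
  then have "[int (m choose q) + 2 * ?y = int (m choose q)] (mod 4)"
    by (simp add: cong_iff_dvd_diff)
  finally show ?thesis .
qed

lemma binomial_pow2_cong_2:
  assumes "r \<ge> 1"
  shows "[int ((2 ^ r * m) choose (2 ^ r * q)) = int (m choose q)] (mod 2)"
  by (intro cong_dvd_modulus[OF binomial_pow2_cong_4[OF assms]]) auto

section \<open>Lower argument shifted by one: part (b)\<close>

text \<open>This is \<open>(k + 1) * binom(n, k + 1) = (n - k) * binom(n, k)\<close> at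
  \<open>n = 2 ^ r * m\<close> and \<open>k = 2 ^ r * q\<close>. Both binomial coefficients vanish
  when \<open>q > m\<close>, so the integer difference \<open>m - q\<close> is harmless.\<close>

lemma binomial_pow2_succ_absorb:
  "(2 ^ r * int q + 1) * int ((2 ^ r * m) choose (2 ^ r * q + 1))
     = 2 ^ r * ((int m - int q) * int ((2 ^ r * m) choose (2 ^ r * q)))"
proof (cases "q \<le> m")
  case True
  have "(2 ^ r * q + 1) * ((2 ^ r * m) choose (2 ^ r * q + 1))
      = (2 ^ r * m - 2 ^ r * q) * ((2 ^ r * m) choose (2 ^ r * q))"
    using binomial_absorb_comp[of "2 ^ r * m" "2 ^ r * q"]
      binomial_absorption[of "2 ^ r * q" "2 ^ r * m"] by simp
  then have "int ((2 ^ r * q + 1) * ((2 ^ r * m) choose (2 ^ r * q + 1)))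
      = int ((2 ^ r * m - 2 ^ r * q) * ((2 ^ r * m) choose (2 ^ r * q)))"
    by (simp only:)
  then show ?thesis
    using True by (simp add: of_nat_diff algebra_simps)
next
  case False
  then have "2 ^ r * m < 2 ^ r * q" by simp
  then have "(2 ^ r * m) choose (2 ^ r * q) = 0" "(2 ^ r * m) choose (2 ^ r * q + 1) = 0"
    by (intro binomial_eq_0; linarith)+
  then show ?thesis by (simp only: of_nat_0 mult_zero_right)
qed

lemma binomial_pow2_succ_dvd:
  assumes "r \<ge> 1"
  shows "2 ^ r dvd int ((2 ^ r * m) choose (2 ^ r * q + 1))"
proof -
  have "2 ^ r dvd (2 ^ r * int q + 1) * int ((2 ^ r * m) choose (2 ^ r * q + 1))"
    unfolding binomial_pow2_succ_absorb by simp
  \<comment> \<open>The second number is odd because \<open>r\<close> is positive.\<close>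
  moreover have "coprime (2 ^ r) (2 ^ r * int q + 1)"
    using assms by simp
  ultimately show ?thesis
    by (simp add: coprime_dvd_mult_right_iff)
qed

lemma binomial_pow2_succ_cong:
  assumes "r \<ge> 1"
  shows "[int ((2 ^ r * m) choose (2 ^ r * q + 1))
           = 2 ^ r * (int m - int q) * int (m choose q)] (mod 2 ^ (r + 1))"
proof -
  let ?X = "int ((2 ^ r * m) choose (2 ^ r * q + 1))"
    and ?A = "int ((2 ^ r * m) choose (2 ^ r * q))"
  \<comment> \<open>\<open>?X\<close> is even, being a multiple of \<open>2 ^ r\<close> with
    \<open>r\<close> positive. Hence multiplying \<open>?X\<close> by \<open>2 ^ r * q + 1\<close>
    does not change it modulo \<open>2 ^ (r + 1)\<close>, and the absorption identity
    applies.\<close>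
  have "(2 ^ r * 2 :: int) dvd 2 ^ r * ?X"
    using binomial_pow2_succ_dvd[OF assms] assms
    by (intro mult_dvd_mono dvd_refl) (metis dvd_power dvd_trans less_le_trans zero_less_one)
  then have "[?X = ?X + int q * (2 ^ r * ?X)] (mod 2 ^ (r + 1))"
    by (simp add: cong_iff_dvd_diff mult.commute)
  also have "?X + int q * (2 ^ r * ?X) = 2 ^ r * ((int m - int q) * ?A)"
    unfolding binomial_pow2_succ_absorb[symmetric] by (simp add: algebra_simps)
  \<comment> \<open>The factor \<open>2 ^ r\<close> in front lifts a congruence modulo 2 to one
    modulo \<open>2 ^ (r + 1)\<close>.\<close>
  also have "[(int m - int q) * ?A = (int m - int q) * int (m choose q)] (mod 2)"
    by (intro cong_mult cong_refl binomial_pow2_cong_2 assms)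
  then have "[2 ^ r * ((int m - int q) * ?A)
      = 2 ^ r * ((int m - int q) * int (m choose q))] (mod 2 ^ (r + 1))"
    by (simp add: cong_iff_dvd_diff mult.commute flip: right_diff_distrib)
  finally show ?thesis by (simp add: mult.assoc)
qed

theorem proposition4p7:
  fixes m q :: nat
  shows
    "(\<forall>r::nat. r \<ge> 1 \<longrightarrow>
        [int ((2 ^ r * m) choose (2 ^ r * q)) = int (m choose q)] (mod 2) \<and>
        [int ((2 ^ r * m) choose (2 ^ r * q)) = int (m choose q)] (mod 4) \<and>
        [int ((2 ^ r * m) choose (2 ^ r * q))
           = int (m choose q) * (1 + 2 * int q * (int m - int q))] (mod 8) \<and>
        (r = 1 \<longrightarrow>
          [int ((2 ^ r * m) choose (2 ^ r * q))
             = int (m choose q) * (1 + 2 * int q * (int m - int q))] (mod 16)) \<and>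
        (r \<ge> 2 \<longrightarrow>
          [int ((2 ^ r * m) choose (2 ^ r * q))
             = int (m choose q) * (1 + 10 * int q * (int m - int q))] (mod 16))) \<and>
     (\<forall>r::nat. 1 \<le> r \<and> r \<le> 3 \<longrightarrow>
        [int ((2 ^ r * m) choose (2 ^ r * q + 1)) = 0] (mod 2 ^ r) \<and>
        [int ((2 ^ r * m) choose (2 ^ r * q + 1))
           = 2 ^ r * (int m - int q) * int (m choose q)] (mod 2 ^ (r + 1)))"
proof -
  have one: "[int ((2 ^ 1 * m) choose (2 ^ 1 * q))
      = int (m choose q) * (1 + 2 * int q * (int m - int q))] (mod 16)"
    using binomial_double_cong[of m q] by simp
  have zero: "[int ((2 ^ r * m) choose (2 ^ r * q + 1)) = 0] (mod 2 ^ r)" if "1 \<le> r" for r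
    unfolding cong_0_iff using that by (rule binomial_pow2_succ_dvd)
  show ?thesis
    using one zero binomial_pow2_cong_2 binomial_pow2_cong_4 binomial_pow2_cong_8
      binomial_pow2_cong_16 binomial_pow2_succ_cong
    by blast
qed

end
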